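(* Let $\mathcal{C}$ be a concrete category satisfying (CFP+) and (SDIP), and let $G$ be an arbitrary group. Then for all $\mathcal{C}$-objects $A$ and $B$, every bijective $\mathcal{C}$-cellular automaton $\tau\colon A^G\to B^G$ is reversible, i.e., the inverse map $\tau^{-1}\colon B^G\to A^G$ is a cellular automaton.
   Context: Concrete categories: a concrete category is a category $\mathcal{C}$ equipped with a faithful functor $U\colon\mathcal{C}\to\mathrm{Set}$. Objects and morphisms are denoted by the same symbols as their underlying sets and maps; a map $f\colon A\to B$ between underlying sets of $\mathcal{C}$-objects is called a $\mathcal{C}$-morphism if it is the underlying map of a (necessarily unique) morphism $A\to B$ in $\mathcal{C}$. A concrete product of a family $(A_i)_{i\in I}$ of $\mathcal{C}$-objects is a product $(P,(\pi_i))$ in $\mathcal{C}$ such that $(U(P),(U(\pi_i)))$ is a product of $(U(A_i))$ in $\mathrm{Set}$; the underlying set of $P$ is then identified with the Cartesian product. (CFP): every finite (possibly empty) family of $\mathcal{C}$-objects has a concrete product. Under (CFP), for a finite set $M$, $A^M$ is a $\mathcal{C}$-object whose underlying set is the set of maps $M\to A$. (C+): for any $\mathcal{C}$-object $A$ and any $\mathcal{C}$-object $B$ with nonempty underlying set, the first projection $\pi\colon A\times B\to A$ is a retraction, i.e. there is a $\mathcal{C}$-morphism $g\colon A\to A\times B$ with $\pi\circ g=\mathrm{Id}_A$. (CFP+) means (CFP) together with (C+). (SDIP): let $\mathcal{C}$ satisfy (CFP) and let $A$ be a $\mathcal{C}$-object. A subset of $A\times A$ is: $\mathcal{C}$-square-algebraic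 if it equals $\{(a_1,a_2): f(a_1)=b_1,\ f(a_2)=b_2\}$ for some $\mathcal{C}$-morphism $f\colon A\to B$ and $(b_1,b_2)\in B\times B$; $\mathcal{C}$-prediagonal if it equals $\{(a_1,a_2): f(a_1)=f(a_2)\}$ for some $\mathcal{C}$-morphism $f\colon A\to B$; $\mathcal{C}$-codiagonal if it equals $\{(a_1,a_2): f(a_1)\neq f(a_2)\}$ for some $\mathcal{C}$-morphism $f\colon A\to B$; $\mathcal{C}$-subdiagonal if it equals $\{(f(b_1),f(b_2)) : (b_1,b_2)\in B\times B,\ g(b_1)=g(b_2)\}$ for some $\mathcal{C}$-morphisms $f\colon B\to A$ and $g\colon B\to C$. $\mathcal{C}$ satisfies (SDIP) (subdiagonal intersection property) if for every $\mathcal{C}$-object $A$, every $\mathcal{C}$-square-algebraic $X\subset A\times A$, every $\mathcal{C}$-codiagonal $Y\subset A\times A$ and every non-increasing sequence $(Z_n)_{n\in\mathbb{N}}$ of $\mathcal{C}$-subdiagonal subsets of $A\times A$ with $X\cap Y\cap Z_n\neq\varnothing$ for all $n$, one has $\bigcap_{n\in\mathbb{N}}(X\cap Y\cap Z_n)\neq\varnothing$. Cellular automata: for a group $G$ and a set $A$, $A^G$ is the set of maps $x\colon G\to A$, with $G$-shift action $(gx)(h)=x(g^{-1}h)$. A map $\tau\colon A^G\to B^G$ is a cellular automaton if there exist a finite subset $M\subset G$ (a memory set) and a map $\mu_M\colon A^M\to B$ (the associated local defining map) such that $\tau(x)(g)=\mu_M((g^{-1}x)|_M)$ for all $x\in A^G$,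 $g\in G$. If $\mathcal{C}$ satisfies (CFP+) and $A,B$ are $\mathcal{C}$-objects, $\tau$ is a $\mathcal{C}$-cellular automaton if it has a memory set $M$ with associated local defining map $\mu_M\colon A^M\to B$ that is a $\mathcal{C}$-morphism. *)

theory Defs
  imports "HOL-Algebra.Group" "HOL-Library.FuncSet"
begin

section \<open>Categories, functors, products\<close>

record ('o, 'm) cat =
  Ob :: "'o set"
  Ar :: "'m set"
  Dom :: "'m \<Rightarrow> 'o"
  Cod :: "'m \<Rightarrow> 'o"
  Ident :: "'o \<Rightarrow> 'm"
  Comp :: "'m \<Rightarrow> 'm \<Rightarrow> 'm"

definition hom_set :: "('o, 'm, 'z) cat_scheme \<Rightarrow> 'o \<Rightarrow> 'o \<Rightarrow> 'm set" where
  "hom_set C A B = {f \<in> Ar C. Dom C f = A \<and> Cod C f = B}"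

locale category =
  fixes C :: "('o, 'm, 'z) cat_scheme" (structure)
  assumes dom_ob: "f \<in> Ar C \<Longrightarrow> Dom C f \<in> Ob C"
    and cod_ob: "f \<in> Ar C \<Longrightarrow> Cod C f \<in> Ob C"
    and ident_hom: "A \<in> Ob C \<Longrightarrow> Ident C A \<in> hom_set C A A"
    and comp_hom: "\<lbrakk>f \<in> hom_set C A B; g \<in> hom_set C B D\<rbrakk> \<Longrightarrow> Comp C g f \<in> hom_set C A D"
    and ident_left: "f \<in> hom_set C A B \<Longrightarrow> Comp C (Ident C B) f = f"
    and ident_right: "f \<in> hom_set C A B \<Longrightarrow> Comp C f (Ident C A) = f"
    and comp_assoc: "\<lbrakk>f \<in> hom_set C A B; g \<in> hom_set C B D; h \<in> hom_set C D E\<rbrakk>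
      \<Longrightarrow> Comp C h (Comp C g f) = Comp C (Comp C h g) f"

definition is_functor ::
  "('o, 'm, 'z) cat_scheme \<Rightarrow> ('p, 'n, 'y) cat_scheme \<Rightarrow> ('o \<Rightarrow> 'p) \<Rightarrow> ('m \<Rightarrow> 'n) \<Rightarrow> bool" where
  "is_functor C D Fo Fa \<longleftrightarrow>
     (\<forall>A\<in>Ob C. Fo A \<in> Ob D) \<and>
     (\<forall>f\<in>Ar C. Fa f \<in> hom_set D (Fo (Dom C f)) (Fo (Cod C f))) \<and>
     (\<forall>A\<in>Ob C. Fa (Ident C A) = Ident D (Fo A)) \<and>
     (\<forall>f\<in>Ar C. \<forall>g\<in>Ar C. Cod C f = Dom C g \<longrightarrow> Fa (Comp C g f) = Comp D (Fa g) (Fa f))"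

definition is_faithful :: "('o, 'm, 'z) cat_scheme \<Rightarrow> ('m \<Rightarrow> 'n) \<Rightarrow> bool" where
  "is_faithful C Fa \<longleftrightarrow> (\<forall>A\<in>Ob C. \<forall>B\<in>Ob C. inj_on Fa (hom_set C A B))"

definition is_product ::
  "('o, 'm, 'z) cat_scheme \<Rightarrow> 'i set \<Rightarrow> ('i \<Rightarrow> 'o) \<Rightarrow> 'o \<Rightarrow> ('i \<Rightarrow> 'm) \<Rightarrow> bool" where
  "is_product C I F P \<pi> \<longleftrightarrow>
     P \<in> Ob C \<and> (\<forall>i\<in>I. \<pi> i \<in> hom_set C P (F i)) \<and>
     (\<forall>Q\<in>Ob C. \<forall>q. (\<forall>i\<in>I. q i \<in> hom_set C Q (F i)) \<longrightarrow>
        (\<exists>!h. h \<in> hom_set C Q P \<and> (\<forall>i\<in>I. Comp C (\<pi> i) h = q i)))"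

text \<open>The category of sets whose elements come from a fixed (arbitrary) type \<open>'u\<close>.
  An arrow carries its domain and codomain; its map is extensional, so that equal maps
  between the same sets are equal arrows.\<close>

type_synonym 'u set_arrow = "'u set \<times> ('u \<Rightarrow> 'u) \<times> 'u set"

definition set_cat :: "('u set, 'u set_arrow) cat" where
  "set_cat = \<lparr>
     Ob = UNIV,
     Ar = {(A, f, B). f \<in> A \<rightarrow>\<^sub>E B},
     Dom = (\<lambda>(A, f, B). A),
     Cod = (\<lambda>(A, f, B). B),
     Ident = (\<lambda>A. (A, (\<lambda>a\<in>A. a), A)),
     Comp = (\<lambda>(B, g, D) (A, f, B'). (A, compose A g f, D))\<rparr>"

lemma hom_set_set_cat: "hom_set set_cat A B = {(A, f, B) | f. f \<in> A \<rightarrow>\<^sub>E B}"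
  by (auto simp: hom_set_def set_cat_def)

lemma category_set_cat: "category set_cat"
proof
  show "Comp set_cat h (Comp set_cat g f) = Comp set_cat (Comp set_cat h g) f"
    if "f \<in> hom_set set_cat A B" "g \<in> hom_set set_cat B D" "h \<in> hom_set set_cat D E"
    for f g h :: "'u set_arrow" and A B D E
    using that unfolding hom_set_set_cat
    by (auto simp: set_cat_def compose_def fun_eq_iff PiE_iff)
  show "Comp set_cat g f \<in> hom_set set_cat A D"
    if "f \<in> hom_set set_cat A B" "g \<in> hom_set set_cat B D"
    for f g :: "'u set_arrow" and A B D
    using that unfolding hom_set_set_cat
    by (auto simp: set_cat_def compose_def PiE_iff)
  show "Comp set_cat (Ident set_cat B) f = f" if "f \<in> hom_set set_cat A B"
    for f :: "'u set_arrow" and A B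
    using that unfolding hom_set_set_cat
    by (fastforce simp: set_cat_def compose_def PiE_iff extensional_def fun_eq_iff)
  show "Comp set_cat f (Ident set_cat A) = f" if "f \<in> hom_set set_cat A B"
    for f :: "'u set_arrow" and A B
    using that unfolding hom_set_set_cat
    by (auto simp: set_cat_def compose_def PiE_iff extensional_def)
qed (auto simp: set_cat_def hom_set_def)


section \<open>Concrete categories\<close>

record ('o, 'm, 'u) concrete_cat = "('o, 'm) cat" +
  UOb :: "'o \<Rightarrow> 'u set"
  UAr :: "'m \<Rightarrow> 'u set_arrow"

locale concrete_category = category C
  for C :: "('o, 'm, 'u, 'z) concrete_cat_scheme" (structure) +
  assumes forgetful_functor: "is_functor C set_cat (UOb C) (UAr C)"
    and forgetful_faithful: "is_faithful C (UAr C)"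

definition umap :: "('o, 'm, 'u, 'z) concrete_cat_scheme \<Rightarrow> 'm \<Rightarrow> 'u \<Rightarrow> 'u" where
  "umap C f = fst (snd (UAr C f))"

text \<open>A map between the underlying sets of two objects is a morphism if it underlies one;
  the values of \<open>\<phi>\<close> outside the underlying set of \<open>A\<close> are irrelevant.\<close>

definition is_morphism ::
  "('o, 'm, 'u, 'z) concrete_cat_scheme \<Rightarrow> 'o \<Rightarrow> 'o \<Rightarrow> ('u \<Rightarrow> 'u) \<Rightarrow> bool" where
  "is_morphism C A B \<phi> \<longleftrightarrow> (\<exists>f\<in>hom_set C A B. \<forall>a\<in>UOb C A. umap C f a = \<phi> a)"

definition is_concrete_product ::
  "('o, 'm, 'u, 'z) concrete_cat_scheme \<Rightarrow> 'i set \<Rightarrow> ('i \<Rightarrow> 'o) \<Rightarrow> 'o \<Rightarrow> ('i \<Rightarrow> 'm) \<Rightarrow> bool" where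
  "is_concrete_product C I F P \<pi> \<longleftrightarrow>
     is_product C I F P \<pi> \<and>
     is_product set_cat I (\<lambda>i. UOb C (F i)) (UOb C P) (\<lambda>i. UAr C (\<pi> i))"

text \<open>The identification of the underlying set of a concrete product with the
  Cartesian product of the underlying sets of the factors.\<close>

definition coords ::
  "('o, 'm, 'u, 'z) concrete_cat_scheme \<Rightarrow> 'i set \<Rightarrow> ('i \<Rightarrow> 'm) \<Rightarrow> 'u \<Rightarrow> 'i \<Rightarrow> 'u" where
  "coords C I \<pi> p = (\<lambda>i\<in>I. umap C (\<pi> i) p)"

lemma bij_betw_coords:
  fixes C :: "('o, 'm, 'u, 'z) concrete_cat_scheme"
  assumes "is_concrete_product C I F P \<pi>"
  shows "bij_betw (coords C I \<pi>) (UOb C P) (PiE I (\<lambda>i. UOb C (F i)))"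
proof -
  let ?U = "UOb C"
  have hom: "UAr C (\<pi> i) \<in> hom_set set_cat (?U P) (?U (F i))" if "i \<in> I" for i
    using assms that by (auto simp: is_concrete_product_def is_product_def)
  have arrow: "UAr C (\<pi> i) = (?U P, umap C (\<pi> i), ?U (F i))
      \<and> umap C (\<pi> i) \<in> ?U P \<rightarrow>\<^sub>E ?U (F i)" if "i \<in> I" for i
    using hom[OF that] by (auto simp: hom_set_set_cat umap_def)
  have unique: "\<exists>!p. p \<in> ?U P \<and> coords C I \<pi> p = x" if x: "x \<in> PiE I (\<lambda>i. ?U (F i))" for x
  proof -
    obtain u :: 'u where True by blast
    let ?pt = "\<lambda>p. (({u}, (\<lambda>_\<in>{u}. p), ?U P) :: 'u set_arrow)"
    let ?q = "\<lambda>i. ({u}, (\<lambda>_\<in>{u}. x i), ?U (F i))"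
    have pt_eq: "(\<lambda>_\<in>{u}. p) = (\<lambda>_\<in>{u}. p') \<longleftrightarrow> p = p'" for p p' :: 'u
      by (metis restrict_apply' singletonI)
    have q: "\<forall>i\<in>I. ?q i \<in> hom_set set_cat {u} (?U (F i))"
      using x by (auto simp: hom_set_set_cat)
    have prod: "\<forall>Q\<in>Ob set_cat. \<forall>q. (\<forall>i\<in>I. q i \<in> hom_set set_cat Q (?U (F i))) \<longrightarrow>
        (\<exists>!h. h \<in> hom_set set_cat Q (?U P) \<and> (\<forall>i\<in>I. Comp set_cat (UAr C (\<pi> i)) h = q i))"
      using assms unfolding is_concrete_product_def is_product_def by (elim conjE) assumption
    have u: "{u} \<in> Ob set_cat" by (simp add: set_cat_def)
    have ex1: "\<exists>!h. h \<in> hom_set set_cat {u} (?U P)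
        \<and> (\<forall>i\<in>I. Comp set_cat (UAr C (\<pi> i)) h = ?q i)"
      by (rule prod[rule_format, OF u, where q = ?q]) (use q in blast)
    have pt: "?pt p \<in> hom_set set_cat {u} (?U P)
          \<and> (\<forall>i\<in>I. Comp set_cat (UAr C (\<pi> i)) (?pt p) = ?q i)
        \<longleftrightarrow> p \<in> ?U P \<and> coords C I \<pi> p = x" for p
    proof -
      have "?pt p \<in> hom_set set_cat {u} (?U P) \<longleftrightarrow> p \<in> ?U P"
        by (auto simp: hom_set_set_cat PiE_iff)
      moreover have "Comp set_cat (UAr C (\<pi> i)) (?pt p) = ?q i \<longleftrightarrow> umap C (\<pi> i) p = x i"
        if "i \<in> I" for i
      proof -
        have "Comp set_cat (UAr C (\<pi> i)) (?pt p)
            = ({u}, (\<lambda>_\<in>{u}. umap C (\<pi> i) p), ?U (F i))"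
          using arrow[OF that]
          by (simp add: set_cat_def compose_def cong: restrict_cong)
        then show ?thesis
          by (simp add: pt_eq)
      qed
      moreover have "coords C I \<pi> p = x \<longleftrightarrow> (\<forall>i\<in>I. umap C (\<pi> i) p = x i)"
        using x by (auto simp: coords_def fun_eq_iff PiE_iff extensional_def)
      ultimately show ?thesis by auto
    qed
    obtain h where h: "h \<in> hom_set set_cat {u} (?U P)"
        "\<forall>i\<in>I. Comp set_cat (UAr C (\<pi> i)) h = ?q i"
      using ex1 by blast
    obtain k where k: "h = ({u}, k, ?U P)" "k \<in> {u} \<rightarrow>\<^sub>E ?U P"
      using h(1) by (auto simp: hom_set_set_cat)
    have "h = ?pt (k u)"
      using k by (auto simp: fun_eq_iff PiE_iff extensional_def)
    with h have "?pt (k u) \<in> hom_set set_cat {u} (?U P)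
        \<and> (\<forall>i\<in>I. Comp set_cat (UAr C (\<pi> i)) (?pt (k u)) = ?q i)"
      by simp
    then have ex: "k u \<in> ?U P \<and> coords C I \<pi> (k u) = x"
      by (simp only: pt)
    have "p = k u" if "p \<in> ?U P \<and> coords C I \<pi> p = x" for p
    proof -
      have "?pt p = ?pt (k u)"
        using that ex unfolding pt[symmetric]
        by (intro Uniq_D[OF conjunct2[OF ex1[unfolded ex1_iff_ex_Uniq]]])
      then show ?thesis by (simp add: pt_eq)
    qed
    with ex show ?thesis by blast
  qed
  have "coords C I \<pi> p \<in> PiE I (\<lambda>i. ?U (F i))" if "p \<in> ?U P" for p
    using arrow that by (auto simp: coords_def PiE_iff)
  with unique show ?thesis
    by (intro bij_betwI') blast+
qed

text \<open>Families indexed by finite sets of natural numbers suffice, since every finite family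
  can be reindexed by such a set.\<close>

definition CFP :: "('o, 'm, 'u, 'z) concrete_cat_scheme \<Rightarrow> bool" where
  "CFP C \<longleftrightarrow> (\<forall>(I :: nat set) F. finite I \<longrightarrow> (\<forall>i\<in>I. F i \<in> Ob C) \<longrightarrow>
     (\<exists>P \<pi>. is_concrete_product C I F P \<pi>))"

text \<open>\<open>P\<close> with \<open>\<pi> 0\<close>, \<open>\<pi> 1\<close> ranges over the concrete products of \<open>A\<close> and \<open>B\<close>; these are unique
  up to isomorphism over the factors.\<close>

definition Cplus :: "('o, 'm, 'u, 'z) concrete_cat_scheme \<Rightarrow> bool" where
  "Cplus C \<longleftrightarrow> (\<forall>A\<in>Ob C. \<forall>B\<in>Ob C. UOb C B \<noteq> {} \<longrightarrow>
     (\<forall>P \<pi>. is_concrete_product C {0, 1 :: nat} (\<lambda>i. if i = 0 then A else B) P \<pi> \<longrightarrow>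
        (\<exists>g\<in>hom_set C A P. Comp C (\<pi> 0) g = Ident C A)))"

definition CFP_plus :: "('o, 'm, 'u, 'z) concrete_cat_scheme \<Rightarrow> bool" where
  "CFP_plus C \<longleftrightarrow> CFP C \<and> Cplus C"


section \<open>The subdiagonal intersection property\<close>

definition square_algebraic ::
  "('o, 'm, 'u, 'z) concrete_cat_scheme \<Rightarrow> 'o \<Rightarrow> ('u \<times> 'u) set \<Rightarrow> bool" where
  "square_algebraic C A X \<longleftrightarrow>
     (\<exists>B\<in>Ob C. \<exists>f\<in>hom_set C A B. \<exists>b1\<in>UOb C B. \<exists>b2\<in>UOb C B.
        X = {(a1, a2) \<in> UOb C A \<times> UOb C A. umap C f a1 = b1 \<and> umap C f a2 = b2})"

definition codiagonal ::
  "('o, 'm, 'u, 'z) concrete_cat_scheme \<Rightarrow> 'o \<Rightarrow> ('u \<times> 'u) set \<Rightarrow> bool" where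
  "codiagonal C A Y \<longleftrightarrow>
     (\<exists>B\<in>Ob C. \<exists>f\<in>hom_set C A B.
        Y = {(a1, a2) \<in> UOb C A \<times> UOb C A. umap C f a1 \<noteq> umap C f a2})"

definition subdiagonal ::
  "('o, 'm, 'u, 'z) concrete_cat_scheme \<Rightarrow> 'o \<Rightarrow> ('u \<times> 'u) set \<Rightarrow> bool" where
  "subdiagonal C A Z \<longleftrightarrow>
     (\<exists>B\<in>Ob C. \<exists>D\<in>Ob C. \<exists>f\<in>hom_set C B A. \<exists>g\<in>hom_set C B D.
        Z = {(umap C f b1, umap C f b2) | b1 b2.
               b1 \<in> UOb C B \<and> b2 \<in> UOb C B \<and> umap C g b1 = umap C g b2})"

definition SDIP :: "('o, 'm, 'u, 'z) concrete_cat_scheme \<Rightarrow> bool" where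
  "SDIP C \<longleftrightarrow>
     (\<forall>A\<in>Ob C. \<forall>X Y. \<forall>Z :: nat \<Rightarrow> ('u \<times> 'u) set.
        square_algebraic C A X \<longrightarrow> codiagonal C A Y \<longrightarrow>
        (\<forall>n. subdiagonal C A (Z n)) \<longrightarrow> antimono Z \<longrightarrow>
        (\<forall>n. X \<inter> Y \<inter> Z n \<noteq> {}) \<longrightarrow> (\<Inter>n. X \<inter> Y \<inter> Z n) \<noteq> {})"


section \<open>Cellular automata\<close>

definition configs :: "('g, 'y) monoid_scheme \<Rightarrow> 'a set \<Rightarrow> ('g \<Rightarrow> 'a) set" where
  "configs G A = (carrier G \<rightarrow>\<^sub>E A)"

definition shift :: "('g, 'y) monoid_scheme \<Rightarrow> 'g \<Rightarrow> ('g \<Rightarrow> 'a) \<Rightarrow> 'g \<Rightarrow> 'a" where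
  "shift G g x = (\<lambda>h\<in>carrier G. x (inv\<^bsub>G\<^esub> g \<otimes>\<^bsub>G\<^esub> h))"

definition local_defining_map ::
  "('g, 'y) monoid_scheme \<Rightarrow> 'a set \<Rightarrow> 'b set \<Rightarrow> (('g \<Rightarrow> 'a) \<Rightarrow> 'g \<Rightarrow> 'b) \<Rightarrow>
     'g set \<Rightarrow> (('g \<Rightarrow> 'a) \<Rightarrow> 'b) \<Rightarrow> bool" where
  "local_defining_map G A B \<tau> M \<mu> \<longleftrightarrow>
     finite M \<and> M \<subseteq> carrier G \<and> \<mu> \<in> (M \<rightarrow>\<^sub>E A) \<rightarrow> B \<and>
     (\<forall>x\<in>configs G A. \<forall>g\<in>carrier G. \<tau> x g = \<mu> (restrict (shift G (inv\<^bsub>G\<^esub> g) x) M))"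

definition cellular_automaton ::
  "('g, 'y) monoid_scheme \<Rightarrow> 'a set \<Rightarrow> 'b set \<Rightarrow> (('g \<Rightarrow> 'a) \<Rightarrow> 'g \<Rightarrow> 'b) \<Rightarrow> bool" where
  "cellular_automaton G A B \<tau> \<longleftrightarrow>
     \<tau> \<in> configs G A \<rightarrow> configs G B \<and> (\<exists>M \<mu>. local_defining_map G A B \<tau> M \<mu>)"

text \<open>\<open>\<mu>\<close> is a morphism from \<open>A\<^sup>M\<close> to \<open>B\<close>, where \<open>A\<^sup>M\<close> is a concrete product \<open>P\<close> of the
  constant family \<open>A\<close> over \<open>M\<close>, with points identified with maps from \<open>M\<close> via \<open>coords\<close>.
  The choice of \<open>P\<close> does not matter.\<close>

definition power_morphism ::
  "('o, 'm, 'u, 'z) concrete_cat_scheme \<Rightarrow> 'i set \<Rightarrow> 'o \<Rightarrow> 'o \<Rightarrow> (('i \<Rightarrow> 'u) \<Rightarrow> 'u) \<Rightarrow> bool" where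
  "power_morphism C M A B \<mu> \<longleftrightarrow>
     (\<exists>P \<pi>. is_concrete_product C M (\<lambda>_. A) P \<pi> \<and> is_morphism C P B (\<lambda>p. \<mu> (coords C M \<pi> p)))"

definition C_cellular_automaton ::
  "('o, 'm, 'u, 'z) concrete_cat_scheme \<Rightarrow> ('g, 'y) monoid_scheme \<Rightarrow> 'o \<Rightarrow> 'o \<Rightarrow>
     (('g \<Rightarrow> 'u) \<Rightarrow> 'g \<Rightarrow> 'u) \<Rightarrow> bool" where
  "C_cellular_automaton C G A B \<tau> \<longleftrightarrow>
     \<tau> \<in> configs G (UOb C A) \<rightarrow> configs G (UOb C B) \<and>
     (\<exists>M \<mu>. local_defining_map G (UOb C A) (UOb C B) \<tau> M \<mu> \<and> power_morphism C M A B \<mu>)"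

end

theory Submission
  imports Defs
begin

text \<open>The inverse of a bijective cellular automaton \<open>\<tau>\<close> commutes with the shift, so it is a
  cellular automaton as soon as \<open>\<tau>\<^sup>-\<^sup>1 y\<close> at \<open>\<one>\<close> depends only on the restriction of \<open>y\<close> to some
  finite set (\<open>cellular_automatonI\<close>). Suppose that no finite set has this property. Let \<open>M\<close> be a
  memory set whose local defining map is a morphism, and let \<open>E n\<close> be the ball of radius \<open>n\<close> about
  \<open>\<one>\<close> in the Cayley graph of \<open>M\<close>. Then for every \<open>n\<close> there are two configurations that differ at
  \<open>\<one>\<close> but whose images under \<open>\<tau>\<close> agree on \<open>E n\<close>.

  The patterns on \<open>E n\<close> form the \<open>\<C>\<close>-object \<open>A\<close> to the power \<open>E n\<close>. On it, having the same image
  wherever \<open>\<tau>\<close> can be computed from the pattern is a prediagonal condition, and differing at \<open>\<one>\<close> is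
  a codiagonal one. Thus there is an inverse sequence of nonempty sets of pairs, and what matters is
  that its limit is nonempty. This is a Mittag-Leffler argument (\<open>sdip_inverse_limit\<close>): images
  of later prediagonal sets are subdiagonal, so SDIP says that pairs exist that lift to all later
  stages; and since the fibre of a bonding map over a pair is square-algebraic, SDIP also
  says that such a pair lifts to another one of the same kind.

  A point of the limit is a pair of distinct patterns on the union \<open>H\<close> of the balls, which is the
  subgroup generated by \<open>M\<close>. Filled up with one and the same configuration outside \<open>H\<close>, they
  become distinct configurations with the same image (\<open>limit_patterns_same_image\<close>): on \<open>H\<close> by
  construction, and off \<open>H\<close> because \<open>\<tau>\<close> never looks across cosets of \<open>H\<close>. This contradicts
  injectivity. Working with \<open>H\<close> makes uncountable groups no harder than countable ones.\<close>


section \<open>Underlying maps and concrete products\<close>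

context concrete_category
begin

lemma UAr_hom:
  assumes "f \<in> hom_set C A B"
  shows "UAr C f = (UOb C A, umap C f, UOb C B)" "umap C f \<in> UOb C A \<rightarrow>\<^sub>E UOb C B"
proof -
  have "UAr C f \<in> hom_set set_cat (UOb C A) (UOb C B)"
    using forgetful_functor assms by (auto simp: is_functor_def hom_set_def)
  then show "UAr C f = (UOb C A, umap C f, UOb C B)" "umap C f \<in> UOb C A \<rightarrow>\<^sub>E UOb C B"
    by (auto simp: hom_set_set_cat umap_def)
qed

lemma umap_closed: "f \<in> hom_set C A B \<Longrightarrow> a \<in> UOb C A \<Longrightarrow> umap C f a \<in> UOb C B"
  using UAr_hom(2) by (auto simp: PiE_iff)

lemma umap_Comp:
  assumes "f \<in> hom_set C A B" "g \<in> hom_set C B D" "a \<in> UOb C A"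
  shows "umap C (Comp C g f) a = umap C g (umap C f a)"
proof -
  have "UAr C (Comp C g f) = Comp set_cat (UAr C g) (UAr C f)"
    using forgetful_functor assms by (auto simp: is_functor_def hom_set_def)
  also have "\<dots> = (UOb C A, compose (UOb C A) (umap C g) (umap C f), UOb C D)"
    using UAr_hom[OF assms(1)] UAr_hom[OF assms(2)] by (simp add: set_cat_def)
  finally show ?thesis
    using assms(3) by (simp add: umap_def compose_def)
qed

lemma umap_Ident:
  assumes "A \<in> Ob C" "a \<in> UOb C A"
  shows "umap C (Ident C A) a = a"
proof -
  have "UAr C (Ident C A) = Ident set_cat (UOb C A)"
    using forgetful_functor assms by (auto simp: is_functor_def)
  then show ?thesis
    using assms(2) by (simp add: umap_def set_cat_def)
qed

lemma concrete_product_proj: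
  assumes "is_concrete_product C I F P \<pi>"
  shows "P \<in> Ob C" "i \<in> I \<Longrightarrow> \<pi> i \<in> hom_set C P (F i)"
  using assms by (auto simp: is_concrete_product_def is_product_def)

lemma concrete_product_tuple:
  assumes P: "is_concrete_product C I F P \<pi>" and "Q \<in> Ob C"
    and q: "\<And>i. i \<in> I \<Longrightarrow> q i \<in> hom_set C Q (F i)"
  shows "\<exists>h\<in>hom_set C Q P. \<forall>a\<in>UOb C Q. coords C I \<pi> (umap C h a) = (\<lambda>i\<in>I. umap C (q i) a)"
proof -
  have "\<forall>Q\<in>Ob C. \<forall>q. (\<forall>i\<in>I. q i \<in> hom_set C Q (F i)) \<longrightarrow>
        (\<exists>!h. h \<in> hom_set C Q P \<and> (\<forall>i\<in>I. Comp C (\<pi> i) h = q i))"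
    using P unfolding is_concrete_product_def is_product_def by (elim conjE)
  then obtain h where h: "h \<in> hom_set C Q P" "\<forall>i\<in>I. Comp C (\<pi> i) h = q i"
    using assms(2) q by (metis (no_types, lifting))
  have "umap C (\<pi> i) (umap C h a) = umap C (q i) a" if "i \<in> I" "a \<in> UOb C Q" for i a
    using umap_Comp[OF h(1) concrete_product_proj(2)[OF P that(1)] that(2)] h(2) that(1) by simp
  then have "\<forall>a\<in>UOb C Q. coords C I \<pi> (umap C h a) = (\<lambda>i\<in>I. umap C (q i) a)"
    by (auto simp: coords_def intro!: restrict_ext)
  with h(1) show ?thesis by blast
qed

end

lemma is_product_reindex:
  assumes P: "is_product C I F P \<pi>" and e: "bij_betw e J I"
    and F': "\<And>j. j \<in> J \<Longrightarrow> F' j = F (e j)"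
  shows "is_product C J F' P (\<pi> \<circ> e)"
  unfolding is_product_def
proof (intro conjI ballI allI impI)
  have uniq: "\<forall>Q\<in>Ob C. \<forall>q. (\<forall>i\<in>I. q i \<in> hom_set C Q (F i)) \<longrightarrow>
        (\<exists>!h. h \<in> hom_set C Q P \<and> (\<forall>i\<in>I. Comp C (\<pi> i) h = q i))"
    using P unfolding is_product_def by (elim conjE)
  show "P \<in> Ob C"
    using P by (simp add: is_product_def)
  show "(\<pi> \<circ> e) j \<in> hom_set C P (F' j)" if "j \<in> J" for j
    using P that bij_betwE[OF e] by (simp add: is_product_def F')
  fix Q q assume Q: "Q \<in> Ob C" and q: "\<forall>j\<in>J. q j \<in> hom_set C Q (F' j)"
  let ?d = "inv_into J e"
  have d: "?d i \<in> J" "e (?d i) = i" if "i \<in> I" for i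
    using that e by (auto simp: bij_betw_def f_inv_into_f inv_into_into)
  have ed: "?d (e j) = j" "e j \<in> I" if "j \<in> J" for j
    using that e by (auto simp: bij_betw_def)
  have "\<forall>i\<in>I. q (?d i) \<in> hom_set C Q (F i)"
    using q d F' by metis
  then have "\<exists>!h. h \<in> hom_set C Q P \<and> (\<forall>i\<in>I. Comp C (\<pi> i) h = q (?d i))"
    using uniq[THEN bspec, OF Q, THEN spec, of "\<lambda>i. q (?d i)"] by (rule rev_mp)
  moreover have "(\<forall>i\<in>I. Comp C (\<pi> i) h = q (?d i)) \<longleftrightarrow> (\<forall>j\<in>J. Comp C ((\<pi> \<circ> e) j) h = q j)" for h
    using d ed by (metis comp_apply)
  ultimately show "\<exists>!h. h \<in> hom_set C Q P \<and> (\<forall>j\<in>J. Comp C ((\<pi> \<circ> e) j) h = q j)"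
    by simp
qed

lemma CFP_concrete_product:
  assumes "CFP C" "finite J" "\<And>j. j \<in> J \<Longrightarrow> F j \<in> Ob C"
  shows "\<exists>P \<pi>. is_concrete_product C J F P \<pi>"
proof -
  obtain e where e: "bij_betw e J {0..<card J}"
    using ex_bij_betw_finite_nat[OF assms(2)] by blast
  let ?F = "F \<circ> inv_into J e"
  have F: "F j = ?F (e j)" if "j \<in> J" for j
    using that e by (simp add: bij_betw_def)
  have "\<forall>i\<in>{0..<card J}. ?F i \<in> Ob C"
    using assms(3) e by (auto simp: bij_betw_def inv_into_into)
  then obtain P \<pi> where "is_concrete_product C {0..<card J} ?F P \<pi>"
    using assms(1) unfolding CFP_def by blast
  then have "is_concrete_product C J F P (\<pi> \<circ> e)"
    unfolding is_concrete_product_def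
    using is_product_reindex[OF _ e, of C ?F P \<pi> F] F
      is_product_reindex[OF _ e, of set_cat "\<lambda>i. UOb C (?F i)" "UOb C P" "\<lambda>i. UAr C (\<pi> i)"
        "\<lambda>j. UOb C (F j)"]
    by (simp add: comp_def)
  then show ?thesis by blast
qed

text \<open>The empty product is a terminal object with one point; every pair of points has the same
  image there.\<close>

lemma (in concrete_category) square_algebraic_full:
  assumes "CFP C" "A \<in> Ob C"
  shows "square_algebraic C A (UOb C A \<times> UOb C A)"
proof -
  obtain T \<pi> where T: "is_concrete_product C ({} :: nat set) (\<lambda>_. A) T \<pi>"
    using CFP_concrete_product[OF assms(1), of "{} :: nat set" "\<lambda>_. A"] by auto
  obtain h where h: "h \<in> hom_set C A T"
    using concrete_product_tuple[OF T assms(2), of "\<lambda>_. undefined"] by auto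
  have "bij_betw (coords C {} \<pi>) (UOb C T) {\<lambda>_. undefined}"
    using bij_betw_coords[OF T] by simp
  then obtain t where "UOb C T = {t}"
    by (metis bij_betw_same_card card_1_singletonE card.empty card.insert empty_iff finite.emptyI
        One_nat_def)
  moreover have "umap C h a \<in> UOb C T" if "a \<in> UOb C A" for a
    using umap_closed[OF h that] .
  ultimately have "UOb C A \<times> UOb C A =
      {(a1, a2) \<in> UOb C A \<times> UOb C A. umap C h a1 = t \<and> umap C h a2 = t}" "t \<in> UOb C T"
    by auto
  then show ?thesis
    unfolding square_algebraic_def using concrete_product_proj(1)[OF T] h by blast
qed


section \<open>Inverse limits under SDIP\<close>

text \<open>Mittag-Leffler for pairs of points. The set \<open>U n\<close> of the pairs at stage \<open>n\<close> that lift to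
  every later stage is the intersection of a codiagonal set with a decreasing sequence of
  subdiagonal sets, so SDIP gives a point of \<open>U 0\<close>. Adding the square-algebraic condition of lying
  over a given point of \<open>U n\<close>, SDIP gives surjectivity of \<open>U (n + 1) \<rightarrow> U n\<close>.\<close>

lemma (in concrete_category) sdip_inverse_limit:
  fixes P D :: "nat \<Rightarrow> 'o" and R :: "nat \<Rightarrow> nat \<Rightarrow> 'm" and f :: "nat \<Rightarrow> 'm"
  assumes "CFP C" "SDIP C"
    and P: "\<And>n. P n \<in> Ob C"
    and R: "\<And>n m. n \<le> m \<Longrightarrow> R n m \<in> hom_set C (P m) (P n)"
    and R_refl: "\<And>n a. a \<in> UOb C (P n) \<Longrightarrow> umap C (R n n) a = a"
    and R_comp: "\<And>n m k a. \<lbrakk>n \<le> m; m \<le> k; a \<in> UOb C (P k)\<rbrakk>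
      \<Longrightarrow> umap C (R n m) (umap C (R m k) a) = umap C (R n k) a"
    and f: "\<And>n. f n \<in> hom_set C (P n) (D n)"
    and f_R: "\<And>n m a b. \<lbrakk>n \<le> m; a \<in> UOb C (P m); b \<in> UOb C (P m); umap C (f m) a = umap C (f m) b\<rbrakk>
      \<Longrightarrow> umap C (f n) (umap C (R n m) a) = umap C (f n) (umap C (R n m) b)"
    and nonempty: "\<And>n. \<exists>a\<in>UOb C (P n). \<exists>b\<in>UOb C (P n). umap C (f n) a = umap C (f n) b
      \<and> umap C (R 0 n) a \<noteq> umap C (R 0 n) b"
  obtains a b where "\<And>n. a n \<in> UOb C (P n)" "\<And>n. b n \<in> UOb C (P n)"
    "\<And>n. umap C (f n) (a n) = umap C (f n) (b n)"
    "\<And>n m. n \<le> m \<Longrightarrow> umap C (R n m) (a m) = a n" "\<And>n m. n \<le> m \<Longrightarrow> umap C (R n m) (b m) = b n"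
    "a 0 \<noteq> b 0"
proof -
  define Y where "Y n = {(a, b) \<in> UOb C (P n) \<times> UOb C (P n). umap C (R 0 n) a \<noteq> umap C (R 0 n) b}" for n
  define Z where "Z n k = {(umap C (R n (n + k)) a, umap C (R n (n + k)) b) | a b.
      a \<in> UOb C (P (n + k)) \<and> b \<in> UOb C (P (n + k)) \<and> umap C (f (n + k)) a = umap C (f (n + k)) b}"
    for n k
  define U where "U n = (\<Inter>k. Y n \<inter> Z n k)" for n
  have D: "D n \<in> Ob C" for n
    using f[of n] cod_ob[of "f n"] by (auto simp: hom_set_def)
  have Rin: "umap C (R n m) a \<in> UOb C (P n)" if "n \<le> m" "a \<in> UOb C (P m)" for n m a
    using umap_closed[OF R] that .
  have Y: "codiagonal C (P n) (Y n)" for n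
    unfolding codiagonal_def Y_def using P[of 0] R[of 0 n] by blast
  have Z: "subdiagonal C (P n) (Z n k)" for n k
    unfolding subdiagonal_def Z_def using P[of "n + k"] D[of "n + k"] R[of n "n + k"] f[of "n + k"]
    by (intro bexI[of _ "P (n + k)"] bexI[of _ "D (n + k)"] bexI[of _ "R n (n + k)"]
        bexI[of _ "f (n + k)"]) auto
  have antimono: "antimono (Z n)" for n
  proof (rule antimonoI, erule lift_Suc_antimono_le[rotated], rule subsetI)
    fix k p assume "p \<in> Z n (Suc k)"
    then obtain a b where ab: "p = (umap C (R n (Suc (n + k))) a, umap C (R n (Suc (n + k))) b)"
      "a \<in> UOb C (P (Suc (n + k)))" "b \<in> UOb C (P (Suc (n + k)))"
      "umap C (f (Suc (n + k))) a = umap C (f (Suc (n + k))) b"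
      unfolding Z_def by auto
    let ?a = "umap C (R (n + k) (Suc (n + k))) a" and ?b = "umap C (R (n + k) (Suc (n + k))) b"
    have "p = (umap C (R n (n + k)) ?a, umap C (R n (n + k)) ?b)"
      using ab by (simp add: R_comp)
    moreover have "?a \<in> UOb C (P (n + k))" "?b \<in> UOb C (P (n + k))"
      using ab Rin by auto
    moreover have "umap C (f (n + k)) ?a = umap C (f (n + k)) ?b"
      using ab by (intro f_R) auto
    ultimately show "p \<in> Z n k"
      unfolding Z_def by blast
  qed
  have sdip: "\<exists>p. p \<in> X \<and> p \<in> U n"
    if "square_algebraic C (P n) X" "\<And>k. X \<inter> Y n \<inter> Z n k \<noteq> {}" for X n
  proof -
    have "(\<Inter>k. X \<inter> Y n \<inter> Z n k) \<noteq> {}"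
      using \<open>SDIP C\<close>[unfolded SDIP_def, rule_format, OF P[of n] that(1) Y Z antimono] that(2) by simp
    then show ?thesis
      unfolding U_def by auto
  qed
  have start: "\<exists>p. p \<in> U 0"
  proof -
    have "(UOb C (P 0) \<times> UOb C (P 0)) \<inter> Y 0 \<inter> Z 0 k \<noteq> {}" for k
    proof -
      obtain a b where "a \<in> UOb C (P k)" "b \<in> UOb C (P k)" "umap C (f k) a = umap C (f k) b"
        "umap C (R 0 k) a \<noteq> umap C (R 0 k) b"
        using nonempty by blast
      then have "(umap C (R 0 k) a, umap C (R 0 k) b) \<in> (UOb C (P 0) \<times> UOb C (P 0)) \<inter> Y 0 \<inter> Z 0 k"
        using Rin[of 0 k] by (auto simp: Y_def Z_def R_refl)
      then show ?thesis by blast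
    qed
    then show ?thesis
      using sdip[OF square_algebraic_full[OF \<open>CFP C\<close> P[of 0]]] by blast
  qed
  have step: "\<exists>q. q \<in> U (Suc n) \<and> p = map_prod (umap C (R n (Suc n))) (umap C (R n (Suc n))) q"
    if "p \<in> U n" for n p
  proof -
    obtain a b where p: "p = (a, b)" by (cases p)
    have ab: "a \<in> UOb C (P n)" "b \<in> UOb C (P n)" "umap C (R 0 n) a \<noteq> umap C (R 0 n) b"
      using that p by (auto simp: U_def Y_def)
    let ?r = "umap C (R n (Suc n))"
    let ?X = "{(a', b') \<in> UOb C (P (Suc n)) \<times> UOb C (P (Suc n)). ?r a' = a \<and> ?r b' = b}"
    have X: "square_algebraic C (P (Suc n)) ?X"
      unfolding square_algebraic_def using P[of n] R[of n "Suc n"] ab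
      by (intro bexI[of _ "P n"] bexI[of _ "R n (Suc n)"] bexI[of _ a] bexI[of _ b]) auto
    have "?X \<inter> Y (Suc n) \<inter> Z (Suc n) k \<noteq> {}" for k
    proof -
      have "(a, b) \<in> Z n (Suc k)"
        using that p by (auto simp: U_def)
      then obtain c d where cd: "a = umap C (R n (Suc (n + k))) c" "b = umap C (R n (Suc (n + k))) d"
        "c \<in> UOb C (P (Suc (n + k)))" "d \<in> UOb C (P (Suc (n + k)))"
        "umap C (f (Suc (n + k))) c = umap C (f (Suc (n + k))) d"
        unfolding Z_def by auto
      let ?c = "umap C (R (Suc n) (Suc (n + k))) c" and ?d = "umap C (R (Suc n) (Suc (n + k))) d"
      have "?r ?c = a" "?r ?d = b"
        using cd by (simp_all add: R_comp)
      moreover have "?c \<in> UOb C (P (Suc n))" "?d \<in> UOb C (P (Suc n))"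
        using cd Rin by auto
      moreover have "(?c, ?d) \<in> Z (Suc n) k"
        unfolding Z_def using cd by auto
      moreover have "umap C (R 0 (Suc n)) ?c \<noteq> umap C (R 0 (Suc n)) ?d"
        using ab(3) cd by (simp add: R_comp)
      ultimately have "(?c, ?d) \<in> ?X \<inter> Y (Suc n) \<inter> Z (Suc n) k"
        by (simp add: Y_def)
      then show ?thesis by blast
    qed
    with sdip[OF X] obtain q where "q \<in> ?X" "q \<in> U (Suc n)" by blast
    then show ?thesis
      using p by (intro exI[of _ q]) auto
  qed
  obtain p where p: "\<And>n. p n \<in> U n"
    "\<And>n. p n = map_prod (umap C (R n (Suc n))) (umap C (R n (Suc n))) (p (Suc n))"
    using dependent_nat_choice[of "\<lambda>n p. p \<in> U n"
        "\<lambda>n p q. p = map_prod (umap C (R n (Suc n))) (umap C (R n (Suc n))) q"] start step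
    by metis
  define a where "a = fst \<circ> p"
  define b where "b = snd \<circ> p"
  have pab: "(a n, b n) \<in> U n" for n
    using p(1)[of n] by (simp add: a_def b_def)
  then have Yab: "(a n, b n) \<in> Y n" and Zab: "(a n, b n) \<in> Z n 0" for n
    by (auto simp: U_def)
  have succ: "umap C (R n (Suc n)) (a (Suc n)) = a n" "umap C (R n (Suc n)) (b (Suc n)) = b n" for n
    using p(2)[of n] by (simp_all add: a_def b_def)
  have in_P: "a n \<in> UOb C (P n)" "b n \<in> UOb C (P n)" for n
    using Yab[of n] by (auto simp: Y_def)
  show thesis
  proof
    show "a n \<in> UOb C (P n)" "b n \<in> UOb C (P n)" for n
      by (fact in_P)+
    show "umap C (f n) (a n) = umap C (f n) (b n)" for n
      using Zab[of n] by (auto simp: Z_def R_refl)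
    show "umap C (R n m) (a m) = a n" if "n \<le> m" for n m
      using that
    proof (induction m rule: dec_induct)
      case (step m)
      then show ?case using R_comp[of n m "Suc m" "a (Suc m)"] succ(1)[of m] in_P by simp
    qed (simp add: R_refl in_P)
    show "umap C (R n m) (b m) = b n" if "n \<le> m" for n m
      using that
    proof (induction m rule: dec_induct)
      case (step m)
      then show ?case using R_comp[of n m "Suc m" "b (Suc m)"] succ(2)[of m] in_P by simp
    qed (simp add: R_refl in_P)
    show "a 0 \<noteq> b 0"
      using Yab[of 0] by (auto simp: Y_def)
  qed
qed


section \<open>Balls in the Cayley graph\<close>

primrec word_ball :: "('g, 'y) monoid_scheme \<Rightarrow> 'g set \<Rightarrow> nat \<Rightarrow> 'g set" where
  "word_ball G M 0 = {\<one>\<^bsub>G\<^esub>}"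
| "word_ball G M (Suc n) = word_ball G M n \<union> (\<lambda>(g, m). g \<otimes>\<^bsub>G\<^esub> m) ` (word_ball G M n \<times> M)
     \<union> (\<lambda>(g, m). g \<otimes>\<^bsub>G\<^esub> inv\<^bsub>G\<^esub> m) ` (word_ball G M n \<times> M)"

lemma finite_word_ball: "finite M \<Longrightarrow> finite (word_ball G M n)"
  by (induction n) auto

lemma (in group) word_ball_subset: "M \<subseteq> carrier G \<Longrightarrow> word_ball G M n \<subseteq> carrier G"
  by (induction n) auto

lemma word_ball_mono: "n \<le> k \<Longrightarrow> word_ball G M n \<subseteq> word_ball G M k"
  by (rule lift_Suc_mono_le[of "word_ball G M"]) auto

lemma one_in_word_ball: "\<one>\<^bsub>G\<^esub> \<in> word_ball G M n"
  using word_ball_mono[of 0 n G M] by auto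

lemma word_ball_mult: "g \<in> word_ball G M n \<Longrightarrow> m \<in> M \<Longrightarrow> g \<otimes>\<^bsub>G\<^esub> m \<in> word_ball G M (Suc n)"
  by auto

text \<open>This is why the generators enter with their inverses: an element outside all balls has no
  neighbour inside one.\<close>

lemma (in group) word_ball_mult_cancel:
  assumes "M \<subseteq> carrier G" "g \<in> carrier G" "m \<in> M" "g \<otimes> m \<in> word_ball G M n"
  shows "g \<in> word_ball G M (Suc n)"
proof -
  have "g = (g \<otimes> m) \<otimes> inv m"
    using assms by (simp add: m_assoc subset_eq)
  then show ?thesis
    using assms(3,4) by force
qed


section \<open>Recognizing cellular automata\<close>

lemma (in group) shift_closed:
  assumes "x \<in> configs G A" "g \<in> carrier G"
  shows "shift G g x \<in> configs G A"
  using assms by (auto simp: configs_def shift_def)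

lemma (in group) local_defining_map_apply:
  assumes \<tau>: "local_defining_map G A B \<tau> M \<mu>" and "x \<in> configs G A" "g \<in> carrier G"
  shows "\<tau> x g = \<mu> (\<lambda>m\<in>M. x (g \<otimes> m))"
proof -
  have "restrict (shift G (inv g) x) M = (\<lambda>m\<in>M. x (g \<otimes> m))"
    using assms by (auto simp: local_defining_map_def shift_def restrict_def fun_eq_iff)
  then show ?thesis
    using assms by (simp add: local_defining_map_def)
qed

lemma (in group) local_defining_map_equivariant:
  assumes \<tau>: "local_defining_map G A B \<tau> M \<mu>" and \<tau>_closed: "\<tau> \<in> configs G A \<rightarrow> configs G B"
    and x: "x \<in> configs G A" and g: "g \<in> carrier G"
  shows "\<tau> (shift G g x) = shift G g (\<tau> x)"
proof (rule extensionalityI)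
  show "\<tau> (shift G g x) \<in> extensional (carrier G)"
    using funcset_mem[OF \<tau>_closed shift_closed[OF x g]] by (auto simp: configs_def PiE_iff)
  show "shift G g (\<tau> x) \<in> extensional (carrier G)"
    by (simp add: shift_def)
  fix h assume h: "h \<in> carrier G"
  have M: "M \<subseteq> carrier G"
    using \<tau> by (simp add: local_defining_map_def)
  have "(\<lambda>m\<in>M. shift G g x (h \<otimes> m)) = (\<lambda>m\<in>M. x (inv g \<otimes> h \<otimes> m))"
    using M g h by (intro restrict_ext) (auto simp: shift_def m_assoc)
  then have "\<tau> (shift G g x) h = \<tau> x (inv g \<otimes> h)"
    using x g h by (simp add: local_defining_map_apply[OF \<tau>] shift_closed)
  then show "\<tau> (shift G g x) h = shift G g (\<tau> x) h"
    using h by (simp add: shift_def)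
qed

text \<open>Requiring \<open>\<one> \<in> F\<close> makes \<open>F\<close> nonempty. Otherwise, for empty alphabets, there would be an empty
  pattern on \<open>F\<close> although there are no configurations, and no value for the local defining map.\<close>

lemma (in group) cellular_automatonI:
  assumes \<sigma>: "\<sigma> \<in> configs G B \<rightarrow> configs G A"
    and equivariant: "\<And>y g. y \<in> configs G B \<Longrightarrow> g \<in> carrier G \<Longrightarrow> \<sigma> (shift G g y) = shift G g (\<sigma> y)"
    and F: "finite F" "F \<subseteq> carrier G" "\<one> \<in> F"
    and dep: "\<And>y y'. \<lbrakk>y \<in> configs G B; y' \<in> configs G B; restrict y F = restrict y' F\<rbrakk>
      \<Longrightarrow> \<sigma> y \<one> = \<sigma> y' \<one>"
  shows "cellular_automaton G B A \<sigma>"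
proof -
  \<comment> \<open>A pattern on \<open>F\<close> is evaluated at the configuration that repeats its value at \<open>\<one>\<close> outside \<open>F\<close>.\<close>
  define ext where "ext p = (\<lambda>g\<in>carrier G. if g \<in> F then p g else p \<one>)" for p :: "'a \<Rightarrow> 'c"
  have ext: "ext p \<in> configs G B" "restrict (ext p) F = p" if "p \<in> F \<rightarrow>\<^sub>E B" for p
    using that F by (auto simp: ext_def configs_def fun_eq_iff PiE_iff extensional_def subset_eq)
  define \<mu> where "\<mu> p = \<sigma> (ext p) \<one>" for p
  have "\<mu> \<in> (F \<rightarrow>\<^sub>E B) \<rightarrow> A"
    using \<sigma> ext(1) by (fastforce simp: \<mu>_def configs_def Pi_iff PiE_iff)
  moreover have "\<sigma> y g = \<mu> (restrict (shift G (inv g) y) F)"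
    if y: "y \<in> configs G B" and g: "g \<in> carrier G" for y g
  proof -
    let ?y = "shift G (inv g) y"
    have y': "?y \<in> configs G B"
      using shift_closed[OF y inv_closed[OF g]] .
    then have p: "restrict ?y F \<in> F \<rightarrow>\<^sub>E B"
      using F(2) by (auto simp: configs_def)
    have "\<sigma> y g = shift G (inv g) (\<sigma> y) \<one>"
      using g by (simp add: shift_def)
    also have "\<dots> = \<sigma> ?y \<one>"
      using equivariant y g by simp
    also have "\<dots> = \<mu> (restrict ?y F)"
      unfolding \<mu>_def using ext[OF p] y' by (intro dep) auto
    finally show ?thesis .
  qed
  ultimately show ?thesis
    using \<sigma> F unfolding cellular_automaton_def local_defining_map_def by blast
qed

lemma (in group) inverse_equivariant:
  assumes bij: "bij_betw \<tau> (configs G A) (configs G B)"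
    and equivariant: "\<And>x g. x \<in> configs G A \<Longrightarrow> g \<in> carrier G \<Longrightarrow> \<tau> (shift G g x) = shift G g (\<tau> x)"
    and y: "y \<in> configs G B" and g: "g \<in> carrier G"
  shows "the_inv_into (configs G A) \<tau> (shift G g y) = shift G g (the_inv_into (configs G A) \<tau> y)"
proof -
  obtain x where x: "x \<in> configs G A" "y = \<tau> x"
    using bij y by (auto simp: bij_betw_def)
  have inj: "inj_on \<tau> (configs G A)"
    using bij by (simp add: bij_betw_def)
  have "the_inv_into (configs G A) \<tau> (\<tau> (shift G g x)) = shift G g x"
    by (rule the_inv_into_f_f[OF inj shift_closed[OF x(1) g]])
  then show ?thesis
    using x equivariant[OF x(1) g] the_inv_into_f_f[OF inj x(1)] by simp
qed


section \<open>Gluing patterns\<close>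

text \<open>Both families are glued and filled up by the same \<open>x\<close> off the balls. The cells seen from
  a \<open>g\<close> in some ball all lie in the next one, and those seen from any other \<open>g\<close> lie in no ball,
  where the two glued configurations coincide.\<close>

lemma (in group) limit_patterns_same_image:
  fixes u v :: "nat \<Rightarrow> 'a \<Rightarrow> 'c"
  assumes \<tau>: "local_defining_map G A B \<tau> M \<mu>" and \<tau>_closed: "\<tau> \<in> configs G A \<rightarrow> configs G B"
    and x: "x \<in> configs G A"
    and u: "\<And>n. u n \<in> word_ball G M n \<rightarrow>\<^sub>E A" "\<And>n k. n \<le> k \<Longrightarrow> restrict (u k) (word_ball G M n) = u n"
    and v: "\<And>n. v n \<in> word_ball G M n \<rightarrow>\<^sub>E A" "\<And>n k. n \<le> k \<Longrightarrow> restrict (v k) (word_ball G M n) = v n"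
    and same: "\<And>n g. g \<in> word_ball G M n
      \<Longrightarrow> \<mu> (\<lambda>m\<in>M. u (Suc n) (g \<otimes> m)) = \<mu> (\<lambda>m\<in>M. v (Suc n) (g \<otimes> m))"
    and diff: "u 0 \<noteq> v 0"
  shows "\<not> inj_on \<tau> (configs G A)"
proof -
  let ?E = "word_ball G M"
  define glue where "glue w = (\<lambda>g\<in>carrier G. if \<exists>n. g \<in> ?E n then w (LEAST n. g \<in> ?E n) g else x g)"
    for w :: "nat \<Rightarrow> 'a \<Rightarrow> 'c"
  have M: "M \<subseteq> carrier G"
    using \<tau> by (simp add: local_defining_map_def)
  have glue_in: "glue w g = w n g"
    if w: "\<And>n k. n \<le> k \<Longrightarrow> restrict (w k) (?E n) = w n" and g: "g \<in> ?E n" for w n g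
  proof -
    let ?l = "LEAST n. g \<in> ?E n"
    have l: "g \<in> ?E ?l" "?l \<le> n"
      using g by (auto intro: LeastI Least_le)
    have "w ?l g = w n g"
      using w[OF l(2)] l(1) by (metis restrict_apply')
    then show ?thesis
      using g word_ball_subset[OF M, of n] by (auto simp: glue_def)
  qed
  have glue_configs: "glue w \<in> configs G A"
    if "\<And>n. w n \<in> ?E n \<rightarrow>\<^sub>E A" "\<And>n k. n \<le> k \<Longrightarrow> restrict (w k) (?E n) = w n" for w
    unfolding configs_def
  proof (rule PiE_I)
    fix g assume g: "g \<in> carrier G"
    show "glue w g \<in> A"
    proof (cases "\<exists>n. g \<in> ?E n")
      case True
      then obtain n where n: "g \<in> ?E n" by blast
      then show ?thesis using glue_in[of w, OF that(2) n] that(1)[of n] by (auto simp: PiE_iff)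
    next
      case False
      then show ?thesis using g x by (auto simp: glue_def configs_def)
    qed
  qed (simp add: glue_def)
  note uc = glue_configs[of u, OF u] and vc = glue_configs[of v, OF v]
  have "\<tau> (glue u) = \<tau> (glue v)"
  proof (rule extensionalityI)
    show "\<tau> (glue u) \<in> extensional (carrier G)" "\<tau> (glue v) \<in> extensional (carrier G)"
      using \<tau>_closed uc vc by (auto simp: configs_def PiE_iff Pi_iff)
    fix g assume g: "g \<in> carrier G"
    have "\<mu> (\<lambda>m\<in>M. glue u (g \<otimes> m)) = \<mu> (\<lambda>m\<in>M. glue v (g \<otimes> m))"
    proof (cases "\<exists>n. g \<in> ?E n")
      case True
      then obtain n where n: "g \<in> ?E n" by blast
      have "(\<lambda>m\<in>M. glue w (g \<otimes> m)) = (\<lambda>m\<in>M. w (Suc n) (g \<otimes> m))"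
        if "\<And>n k. n \<le> k \<Longrightarrow> restrict (w k) (?E n) = w n" for w
        using glue_in[of w, OF that word_ball_mult[OF n]] by (auto intro: restrict_ext)
      then show ?thesis
        using same[OF n] u(2) v(2) by simp
    next
      case False
      then have "\<nexists>n. g \<otimes> m \<in> ?E n" if "m \<in> M" for m
        using word_ball_mult_cancel[OF M g that] by blast
      then have "(\<lambda>m\<in>M. glue u (g \<otimes> m)) = (\<lambda>m\<in>M. glue v (g \<otimes> m))"
        by (intro restrict_ext) (auto simp: glue_def)
      then show ?thesis by simp
    qed
    then show "\<tau> (glue u) g = \<tau> (glue v) g"
      using local_defining_map_apply[OF \<tau>] uc vc g by simp
  qed
  moreover have "glue u \<noteq> glue v"
  proof
    assume "glue u = glue v"
    then have "u 0 g = v 0 g" if "g \<in> ?E 0" for g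
      using glue_in[of u, OF u(2) that] glue_in[of v, OF v(2) that] by simp
    then have "u 0 = v 0"
      using PiE_ext[OF u(1)[of 0] v(1)[of 0]] by blast
    with diff show False by simp
  qed
  ultimately show ?thesis
    using uc vc by (meson inj_onD)
qed


section \<open>Reversibility\<close>

text \<open>With \<open>mul\<close> the group multiplication, the image of a pattern on \<open>E\<close> is defined at every cell
  of \<open>D\<close>, and it is a tuple of composites of \<open>\<mu>\<close> with tuples of projections. The universal property
  of products makes it a morphism. Only its kernel is recorded, which is what makes the
  condition of having the same image prediagonal.\<close>

lemma (in concrete_category) induced_pattern_morphism:
  assumes "CFP C" "B \<in> Ob C"
    and \<mu>: "power_morphism C M A B \<mu>"
    and P: "is_concrete_product C E (\<lambda>_. A) P \<pi>" and "finite D"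
    and E: "\<And>g m. g \<in> D \<Longrightarrow> m \<in> M \<Longrightarrow> mul g m \<in> E"
  shows "\<exists>Q. \<exists>f\<in>hom_set C P Q. \<forall>a\<in>UOb C P. \<forall>b\<in>UOb C P. umap C f a = umap C f b \<longleftrightarrow>
    (\<forall>g\<in>D. \<mu> (\<lambda>m\<in>M. coords C E \<pi> a (mul g m)) = \<mu> (\<lambda>m\<in>M. coords C E \<pi> b (mul g m)))"
proof -
  obtain S \<rho> l where S: "is_concrete_product C M (\<lambda>_. A) S \<rho>" and l: "l \<in> hom_set C S B"
    "\<And>s. s \<in> UOb C S \<Longrightarrow> umap C l s = \<mu> (coords C M \<rho> s)"
    using \<mu> unfolding power_morphism_def is_morphism_def by blast
  note P_ob = concrete_product_proj(1)[OF P]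
  have "\<exists>k\<in>hom_set C P B. \<forall>a\<in>UOb C P. umap C k a = \<mu> (\<lambda>m\<in>M. coords C E \<pi> a (mul g m))"
    if g: "g \<in> D" for g
  proof -
    obtain h where h: "h \<in> hom_set C P S"
      "\<forall>a\<in>UOb C P. coords C M \<rho> (umap C h a) = (\<lambda>m\<in>M. umap C (\<pi> (mul g m)) a)"
      using concrete_product_tuple[OF S P_ob, of "\<lambda>m. \<pi> (mul g m)"] concrete_product_proj(2)[OF P]
        E[OF g] by blast
    have "(\<lambda>m\<in>M. umap C (\<pi> (mul g m)) a) = (\<lambda>m\<in>M. coords C E \<pi> a (mul g m))" for a
      using E[OF g] by (auto simp: coords_def intro: restrict_ext)
    then have "umap C (Comp C l h) a = \<mu> (\<lambda>m\<in>M. coords C E \<pi> a (mul g m))" if "a \<in> UOb C P" for a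
      using that h umap_Comp[OF h(1) l(1)] l(2) umap_closed[OF h(1)] by simp
    then show ?thesis
      using comp_hom[OF h(1) l(1)] by blast
  qed
  then obtain k where k: "\<And>g. g \<in> D \<Longrightarrow> k g \<in> hom_set C P B"
    "\<And>g a. g \<in> D \<Longrightarrow> a \<in> UOb C P \<Longrightarrow> umap C (k g) a = \<mu> (\<lambda>m\<in>M. coords C E \<pi> a (mul g m))"
    by metis
  obtain Q \<kappa> where Q: "is_concrete_product C D (\<lambda>_. B) Q \<kappa>"
    using CFP_concrete_product[OF \<open>CFP C\<close> \<open>finite D\<close>, of "\<lambda>_. B"] \<open>B \<in> Ob C\<close> by blast
  obtain f where f: "f \<in> hom_set C P Q"
    "\<forall>a\<in>UOb C P. coords C D \<kappa> (umap C f a) = (\<lambda>g\<in>D. umap C (k g) a)"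
    using concrete_product_tuple[OF Q P_ob, of k] k(1) by blast
  have "umap C f a = umap C f b \<longleftrightarrow> (\<forall>g\<in>D. umap C (k g) a = umap C (k g) b)"
    if "a \<in> UOb C P" "b \<in> UOb C P" for a b
  proof -
    have "umap C f a = umap C f b \<longleftrightarrow> coords C D \<kappa> (umap C f a) = coords C D \<kappa> (umap C f b)"
      using inj_on_eq_iff[OF bij_betw_imp_inj_on[OF bij_betw_coords[OF Q]]]
        umap_closed[OF f(1)] that by simp
    also have "\<dots> \<longleftrightarrow> (\<forall>g\<in>D. umap C (k g) a = umap C (k g) b)"
      using f(2) that by (simp add: restrict_def fun_eq_iff) meson
    finally show ?thesis .
  qed
  then show ?thesis
    using f(1) k(2) by (intro exI[of _ Q] bexI[of _ f]) auto
qed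

text \<open>The heart of the proof: failure of finite dependence at every radius yields, in the limit,
  failure of injectivity.\<close>

lemma not_inj_on_of_unbounded_dependence:
  fixes C :: "('o, 'm, 'u) concrete_cat" and G :: "('g, 'y) monoid_scheme"
  assumes "concrete_category C" "CFP C" "SDIP C" "group G"
    and A: "A \<in> Ob C" and B: "B \<in> Ob C"
    and \<tau>: "local_defining_map G (UOb C A) (UOb C B) \<tau> M \<mu>"
    and \<tau>_closed: "\<tau> \<in> configs G (UOb C A) \<rightarrow> configs G (UOb C B)"
    and \<mu>: "power_morphism C M A B \<mu>"
    and unbounded: "\<And>n. \<exists>x\<in>configs G (UOb C A). \<exists>x'\<in>configs G (UOb C A).
      (\<forall>g\<in>word_ball G M n. \<tau> x g = \<tau> x' g) \<and> x \<one>\<^bsub>G\<^esub> \<noteq> x' \<one>\<^bsub>G\<^esub>"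
  shows "\<not> inj_on \<tau> (configs G (UOb C A))"
proof -
  interpret concrete_category C by fact
  interpret group G by fact
  let ?E = "word_ball G M"
  have M: "finite M" "M \<subseteq> carrier G"
    using \<tau> by (auto simp: local_defining_map_def)
  have "\<forall>n. \<exists>P \<pi>. is_concrete_product C (?E n) (\<lambda>_. A) P \<pi>"
    using CFP_concrete_product[OF \<open>CFP C\<close> finite_word_ball[OF M(1)] A] by blast
  then obtain P \<pi> where P: "\<And>n. is_concrete_product C (?E n) (\<lambda>_. A) (P n) (\<pi> n)"
    by metis
  note P_ob = concrete_product_proj(1)[OF P]
  define c where "c n = coords C (?E n) (\<pi> n)" for n
  have c_bij: "bij_betw (c n) (UOb C (P n)) (?E n \<rightarrow>\<^sub>E UOb C A)" for n
    unfolding c_def using bij_betw_coords[OF P] .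
  have c_eq: "a = b \<longleftrightarrow> c n a = c n b" if "a \<in> UOb C (P n)" "b \<in> UOb C (P n)" for n a b
    using inj_on_eq_iff[OF bij_betw_imp_inj_on[OF c_bij]] that by metis
  have "\<exists>r\<in>hom_set C (P k) (P n). \<forall>a\<in>UOb C (P k). c n (umap C r a) = restrict (c k a) (?E n)"
    if "n \<le> k" for n k
  proof -
    have sub: "?E n \<subseteq> ?E k"
      using word_ball_mono[OF that] .
    then obtain r where r: "r \<in> hom_set C (P k) (P n)"
      "\<forall>a\<in>UOb C (P k). c n (umap C r a) = (\<lambda>g\<in>?E n. umap C (\<pi> k g) a)"
      unfolding c_def
      using concrete_product_tuple[OF P[of n] P_ob[of k], of "\<pi> k"] concrete_product_proj(2)[OF P[of k]]
      by blast
    moreover have "(\<lambda>g\<in>?E n. umap C (\<pi> k g) a) = restrict (c k a) (?E n)" for a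
      using sub by (auto simp: c_def coords_def restrict_def fun_eq_iff)
    ultimately show ?thesis by auto
  qed
  then obtain R where R: "\<And>n k. n \<le> k \<Longrightarrow> R n k \<in> hom_set C (P k) (P n)"
    "\<And>n k a. n \<le> k \<Longrightarrow> a \<in> UOb C (P k) \<Longrightarrow> c n (umap C (R n k) a) = restrict (c k a) (?E n)"
    by metis
  \<comment> \<open>the cells at which the image of a pattern on the ball is determined by this pattern\<close>
  define D where "D n = {g \<in> ?E n. \<forall>m\<in>M. g \<otimes>\<^bsub>G\<^esub> m \<in> ?E n}" for n
  define w where "w n a g = \<mu> (\<lambda>m\<in>M. c n a (g \<otimes>\<^bsub>G\<^esub> m))" for n a g
  have "finite (D n)" for n
    by (rule finite_subset[OF _ finite_word_ball[OF M(1)]]) (auto simp: D_def)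
  then have "\<forall>n. \<exists>Q. \<exists>f\<in>hom_set C (P n) Q. \<forall>a\<in>UOb C (P n). \<forall>b\<in>UOb C (P n).
      umap C f a = umap C f b \<longleftrightarrow> (\<forall>g\<in>D n. w n a g = w n b g)"
    unfolding w_def c_def
    using induced_pattern_morphism[OF \<open>CFP C\<close> B \<mu> P, of "D _" "\<lambda>g m. g \<otimes>\<^bsub>G\<^esub> m"]
    by (simp add: D_def)
  then obtain Q f where f: "\<And>n. f n \<in> hom_set C (P n) (Q n)"
    "\<And>n a b. a \<in> UOb C (P n) \<Longrightarrow> b \<in> UOb C (P n) \<Longrightarrow>
      umap C (f n) a = umap C (f n) b \<longleftrightarrow> (\<forall>g\<in>D n. w n a g = w n b g)"
    by metis
  have Rin: "umap C (R n k) a \<in> UOb C (P n)" if "n \<le> k" "a \<in> UOb C (P k)" for n k a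
    using umap_closed[OF R(1)] that .
  have D_mono: "D n \<subseteq> D k" if "n \<le> k" for n k
    using word_ball_mono[OF that, of G M] by (auto simp: D_def)
  have w_R: "w n (umap C (R n k) a) g = w k a g"
    if "n \<le> k" "a \<in> UOb C (P k)" "g \<in> D n" for n k a g
  proof -
    have "(\<lambda>m\<in>M. c n (umap C (R n k) a) (g \<otimes>\<^bsub>G\<^esub> m)) = (\<lambda>m\<in>M. c k a (g \<otimes>\<^bsub>G\<^esub> m))"
      using that by (intro restrict_ext) (auto simp: R(2) D_def)
    then show ?thesis by (simp add: w_def)
  qed
  have stage: "\<exists>a\<in>UOb C (P n). \<exists>b\<in>UOb C (P n). umap C (f n) a = umap C (f n) b
      \<and> umap C (R 0 n) a \<noteq> umap C (R 0 n) b" for n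
  proof -
    obtain x x' where x: "x \<in> configs G (UOb C A)" "x' \<in> configs G (UOb C A)"
      and eq: "\<And>g. g \<in> ?E n \<Longrightarrow> \<tau> x g = \<tau> x' g" and ne: "x \<one>\<^bsub>G\<^esub> \<noteq> x' \<one>\<^bsub>G\<^esub>"
      using unbounded[of n] by blast
    have pattern: "\<exists>a\<in>UOb C (P n). c n a = restrict x (?E n)" if "x \<in> configs G (UOb C A)" for x
    proof -
      have "restrict x (?E n) \<in> ?E n \<rightarrow>\<^sub>E UOb C A"
        using that word_ball_subset[OF M(2), of n] by (auto simp: configs_def)
      then show ?thesis
        using c_bij[of n] by (metis bij_betw_imp_surj_on imageE)
    qed
    obtain a b where a: "a \<in> UOb C (P n)" "c n a = restrict x (?E n)"
      and b: "b \<in> UOb C (P n)" "c n b = restrict x' (?E n)"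
      using pattern x by blast
    have w_\<tau>: "w n a g = \<tau> x g" if "c n a = restrict x (?E n)" "x \<in> configs G (UOb C A)" "g \<in> D n"
      for a x g
    proof -
      have "(\<lambda>m\<in>M. c n a (g \<otimes>\<^bsub>G\<^esub> m)) = (\<lambda>m\<in>M. x (g \<otimes>\<^bsub>G\<^esub> m))"
        using that by (intro restrict_ext) (auto simp: D_def)
      moreover have "g \<in> carrier G"
        using that(3) word_ball_subset[OF M(2), of n] by (auto simp: D_def)
      ultimately show ?thesis
        using local_defining_map_apply[OF \<tau> that(2)] by (simp add: w_def)
    qed
    have "w n a g = w n b g" if "g \<in> D n" for g
      using w_\<tau>[OF a(2) x(1) that] w_\<tau>[OF b(2) x(2) that] eq that by (simp add: D_def)
    then have "umap C (f n) a = umap C (f n) b"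
      using f(2) a(1) b(1) by simp
    moreover have "c 0 (umap C (R 0 n) a) \<one>\<^bsub>G\<^esub> \<noteq> c 0 (umap C (R 0 n) b) \<one>\<^bsub>G\<^esub>"
      using R(2)[of 0 n] a b ne one_in_word_ball[of G M n] by simp
    ultimately show ?thesis
      using a(1) b(1) by metis
  qed
  obtain a b where ab: "\<And>n. a n \<in> UOb C (P n)" "\<And>n. b n \<in> UOb C (P n)"
    "\<And>n. umap C (f n) (a n) = umap C (f n) (b n)"
    "\<And>n m. n \<le> m \<Longrightarrow> umap C (R n m) (a m) = a n" "\<And>n m. n \<le> m \<Longrightarrow> umap C (R n m) (b m) = b n"
    "a 0 \<noteq> b 0"
  proof (rule sdip_inverse_limit[where P = P and R = R and f = f and D = Q, OF \<open>CFP C\<close> \<open>SDIP C\<close> P_ob])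
    show "umap C (R n n) a = a" if "a \<in> UOb C (P n)" for n a
    proof -
      have "c n a \<in> extensional (?E n)"
        by (simp add: c_def coords_def)
      then show ?thesis
        using c_eq[OF Rin[OF order_refl that] that] R(2)[OF order_refl that] by (simp add: extensional_restrict)
    qed
    show "umap C (R n m) (umap C (R m k) a) = umap C (R n k) a"
      if "n \<le> m" "m \<le> k" "a \<in> UOb C (P k)" for n m k a
    proof -
      have "c n (umap C (R n m) (umap C (R m k) a)) = restrict (restrict (c k a) (?E m)) (?E n)"
        using that Rin R(2) by simp
      also have "\<dots> = restrict (c k a) (?E n)"
        using word_ball_mono[OF that(1), of G M] by (simp add: Int_absorb1)
      also have "\<dots> = c n (umap C (R n k) a)"
        using that R(2) by simp
      finally show ?thesis
        using c_eq[OF Rin[OF that(1) Rin[OF that(2,3)]] Rin[OF le_trans[OF that(1,2)] that(3)]] by simp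
    qed
    show "umap C (f n) (umap C (R n m) a) = umap C (f n) (umap C (R n m) b)"
      if "n \<le> m" "a \<in> UOb C (P m)" "b \<in> UOb C (P m)" "umap C (f m) a = umap C (f m) b" for n m a b
      using that f(2) Rin w_R D_mono[OF that(1)] by (simp add: subset_eq)
  qed (use R(1) f(1) stage in blast)+
  obtain x where x: "x \<in> configs G (UOb C A)"
    using unbounded by blast
  show ?thesis
  proof (rule limit_patterns_same_image[OF \<tau> \<tau>_closed x, of "\<lambda>n. c n (a n)" "\<lambda>n. c n (b n)"])
    show "c n (a n) \<in> ?E n \<rightarrow>\<^sub>E UOb C A" "c n (b n) \<in> ?E n \<rightarrow>\<^sub>E UOb C A" for n
      using bij_betwE[OF c_bij] ab(1,2) by blast+
    show "restrict (c k (a k)) (?E n) = c n (a n)" "restrict (c k (b k)) (?E n) = c n (b n)"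
      if "n \<le> k" for n k
      using R(2)[OF that] ab(1,2,4,5) that by metis+
    show "\<mu> (\<lambda>m\<in>M. c (Suc n) (a (Suc n)) (g \<otimes>\<^bsub>G\<^esub> m)) = \<mu> (\<lambda>m\<in>M. c (Suc n) (b (Suc n)) (g \<otimes>\<^bsub>G\<^esub> m))"
      if "g \<in> ?E n" for n g
    proof -
      have "g \<in> D (Suc n)"
        using that word_ball_mult[OF that] by (simp add: D_def)
      then show ?thesis
        using ab(3)[of "Suc n"] f(2)[OF ab(1,2)] by (simp add: w_def)
    qed
    show "c 0 (a 0) \<noteq> c 0 (b 0)"
      using ab(6) c_eq[OF ab(1,2)] by simp
  qed
qed

theorem theorem8p7:
  fixes C :: "('o, 'm, 'u) concrete_cat"
    and G :: "('g, 'y) monoid_scheme"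
    and A B :: 'o
    and \<tau> :: "('g \<Rightarrow> 'u) \<Rightarrow> 'g \<Rightarrow> 'u"
  assumes "concrete_category C"
    and "CFP_plus C"
    and "SDIP C"
    and "group G"
    and "A \<in> Ob C" and "B \<in> Ob C"
    and "C_cellular_automaton C G A B \<tau>"
    and "bij_betw \<tau> (configs G (UOb C A)) (configs G (UOb C B))"
  shows "cellular_automaton G (UOb C B) (UOb C A) (the_inv_into (configs G (UOb C A)) \<tau>)"
proof -
  interpret group G by fact
  let ?A = "configs G (UOb C A)" and ?B = "configs G (UOb C B)"
  let ?\<sigma> = "the_inv_into ?A \<tau>"
  obtain M \<mu> where \<tau>: "local_defining_map G (UOb C A) (UOb C B) \<tau> M \<mu>"
    and \<tau>_closed: "\<tau> \<in> ?A \<rightarrow> ?B" and \<mu>: "power_morphism C M A B \<mu>"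
    using assms(7) unfolding C_cellular_automaton_def by blast
  have M: "finite M" "M \<subseteq> carrier G"
    using \<tau> by (auto simp: local_defining_map_def)
  have inj: "inj_on \<tau> ?A"
    using assms(8) by (rule bij_betw_imp_inj_on)
  have \<sigma>: "?\<sigma> y \<in> ?A" "\<tau> (?\<sigma> y) = y" if "y \<in> ?B" for y
    using that assms(8) inj by (auto simp: bij_betw_def intro: the_inv_into_into f_the_inv_into_f[OF inj])
  obtain n where n: "\<And>x x'. \<lbrakk>x \<in> ?A; x' \<in> ?A; \<forall>g\<in>word_ball G M n. \<tau> x g = \<tau> x' g\<rbrakk>
      \<Longrightarrow> x \<one>\<^bsub>G\<^esub> = x' \<one>\<^bsub>G\<^esub>"
    using not_inj_on_of_unbounded_dependence[OF assms(1) _ assms(3,4,5,6) \<tau> \<tau>_closed \<mu>] inj assms(2)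
    unfolding CFP_plus_def by blast
  show ?thesis
  proof (rule cellular_automatonI[where F = "word_ball G M n"])
    show "?\<sigma> \<in> ?B \<rightarrow> ?A"
      using \<sigma>(1) by blast
    show "?\<sigma> (shift G g y) = shift G g (?\<sigma> y)" if "y \<in> ?B" "g \<in> carrier G" for y g
      using inverse_equivariant[OF assms(8) local_defining_map_equivariant[OF \<tau> \<tau>_closed] that] by blast
    show "?\<sigma> y \<one>\<^bsub>G\<^esub> = ?\<sigma> y' \<one>\<^bsub>G\<^esub>"
      if y: "y \<in> ?B" "y' \<in> ?B" "restrict y (word_ball G M n) = restrict y' (word_ball G M n)" for y y'
    proof (rule n)
      show "?\<sigma> y \<in> ?A" "?\<sigma> y' \<in> ?A"
        using \<sigma>(1) y by blast+
      show "\<forall>g\<in>word_ball G M n. \<tau> (?\<sigma> y) g = \<tau> (?\<sigma> y') g"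
        using \<sigma>(2) y by (metis restrict_apply')
    qed
  qed (use M in \<open>simp_all add: finite_word_ball word_ball_subset one_in_word_ball\<close>)
qed

end
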